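(* Let $n\ge0$ and let $({\bf s},2n)=(s_0,\dots,s_{2n})$ be a sequence of real numbers such that $\det S_n=0$, where $S_k=(s_{i+j})_{i,j=0}^k$. Then the Hankel rank of the sequence $({\bf s},2n)$ coincides with the largest normal index $n_N$ of the Hankel matrix $S_n$.
   Context: Normal indices of $S_n$ are the integers $j\in\{1,\dots,n+1\}$ with $\det S_{j-1}\neq0$; $n_N$ denotes the largest of them ($n_N:=0$ if there are none). The Hankel rank of $({\bf s},2n)$ is $n+1$ if $\det S_n\ne0$; otherwise it is the smallest integer $r$, $0\le r\le n$, such that $(s_r,\dots,s_{r+n})^\top\in\operatorname{span}\{(s_i,\dots,s_{i+n})^\top:0\le i\le r-1\}$ (the span of the empty set being $\{0\}$). *)

theory Defs
  imports "Jordan_Normal_Form.Determinant" "Jordan_Normal_Form.VS_Connect"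
begin

text \<open>
  A sequence \<open>(s_0, \<dots>, s_{2n})\<close> is represented by a function \<open>s :: nat \<Rightarrow> real\<close> together with \<open>n\<close>;
  only the values \<open>s 0, \<dots>, s (2 * n)\<close> enter the definitions below.  Note that \<open>hankel_mat s k\<close>,
  the matrix \<open>S_k\<close>, has size \<open>k + 1\<close>.
\<close>

definition hankel_mat :: "(nat \<Rightarrow> real) \<Rightarrow> nat \<Rightarrow> real mat" where
  "hankel_mat s k = mat (k + 1) (k + 1) (\<lambda>(i, j). s (i + j))"

definition normal_indices :: "(nat \<Rightarrow> real) \<Rightarrow> nat \<Rightarrow> nat set" where
  "normal_indices s n = {j \<in> {1..n + 1}. det (hankel_mat s (j - 1)) \<noteq> 0}"

definition largest_normal_index :: "(nat \<Rightarrow> real) \<Rightarrow> nat \<Rightarrow> nat" where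
  "largest_normal_index s n =
    (if normal_indices s n = {} then 0 else Max (normal_indices s n))"

definition hankel_col :: "(nat \<Rightarrow> real) \<Rightarrow> nat \<Rightarrow> nat \<Rightarrow> real vec" where
  "hankel_col s n i = vec (n + 1) (\<lambda>k. s (i + k))"

text \<open>
  If \<open>S_n\<close> is singular, its columns \<open>hankel_col s n 0, \<dots>, hankel_col s n n\<close> are linearly dependent,
  so an \<open>r\<close> as required by \<open>LEAST\<close> exists.
\<close>

definition hankel_rank :: "(nat \<Rightarrow> real) \<Rightarrow> nat \<Rightarrow> nat" where
  "hankel_rank s n =
    (if det (hankel_mat s n) \<noteq> 0 then n + 1
     else LEAST r. r \<le> n \<and>
       hankel_col s n r \<in> LinearCombinations.module.span class_ring (module_vec TYPE(real) (n + 1))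
         (hankel_col s n ` {..<r}))"

end

theory Submission
  imports Defs
begin

text \<open>
  Let \<open>r\<close> be the Hankel rank. The dependence of column \<open>r\<close> on the columns before it is a linear
  recurrence of order \<open>r\<close> satisfied by \<open>s\<close>. Restricted to the first \<open>k + 1\<close> rows it makes every
  \<open>S_k\<close> with \<open>r \<le> k \<le> n\<close> singular. Conversely, by the recurrence a kernel vector of \<open>S_{r-1}\<close>
  annihilates not only the first \<open>r\<close> rows but all rows of the first \<open>r\<close> columns of \<open>S_n\<close>; so one
  of these columns would depend on its predecessors, against the minimality of \<open>r\<close>.
\<close>

text \<open>Coefficients are attached to positions in the list, via \<open>lincomb_list\<close>, and
  not to vectors of the set. Entries of \<open>vs\<close> may therefore repeat, as Hankel columns
  can.\<close>

lemma in_span_set_iff_coeffs: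
  fixes v :: "'a :: field vec"
  assumes "set vs \<subseteq> carrier_vec n" and "v \<in> carrier_vec n"
  shows "v \<in> LinearCombinations.module.span class_ring (module_vec TYPE('a) n) (set vs) \<longleftrightarrow>
    (\<exists>a. \<forall>k<n. v $ k = (\<Sum>j<length vs. a j * vs ! j $ k))"
proof -
  interpret vec_space "TYPE('a)" n .
  have dims: "\<forall>w\<in>set vs. dim_vec w = n"
    using assms(1) by auto
  have eq_iff: "v = lincomb_list a vs \<longleftrightarrow> (\<forall>k<n. v $ k = (\<Sum>j<length vs. a j * vs ! j $ k))" for a
  proof -
    have "lincomb_list a vs = mat_of_cols n vs *\<^sub>v vec (length vs) a"
      by (rule lincomb_list_as_mat_mult[OF dims])
    moreover have "(mat_of_cols n vs *\<^sub>v vec (length vs) a) $ k = (\<Sum>j<length vs. a j * vs ! j $ k)"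
      if "k < n" for k
      using that by (simp add: scalar_prod_def mat_of_cols_index lessThan_atLeast0 mult.commute)
    ultimately show ?thesis
      using assms(2) by (auto simp: vec_eq_iff)
  qed
  have "v \<in> span (set vs) \<longleftrightarrow> v \<in> span_list vs"
    using span_list_as_span[OF assms(1)] by simp
  also have "\<dots> \<longleftrightarrow> (\<exists>a. v = lincomb_list a vs)"
    unfolding span_list_def by (auto simp: class_ring_simps)
  finally show ?thesis
    using eq_iff by simp
qed

lemma hankel_col_in_span_iff:
  "hankel_col s n r \<in> LinearCombinations.module.span class_ring (module_vec TYPE(real) (n + 1))
      (hankel_col s n ` {..<r}) \<longleftrightarrow>
    (\<exists>a. \<forall>k\<le>n. s (r + k) = (\<Sum>j<r. a j * s (j + k)))"
proof -
  let ?vs = "map (hankel_col s n) [0..<r]"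
  have "set ?vs \<subseteq> carrier_vec (n + 1)" and "hankel_col s n r \<in> carrier_vec (n + 1)"
    by (auto simp: hankel_col_def)
  from in_span_set_iff_coeffs[OF this]
  have "hankel_col s n r \<in> LinearCombinations.module.span class_ring (module_vec TYPE(real) (n + 1))
      (set ?vs) \<longleftrightarrow> (\<exists>a. \<forall>k<n + 1. s (r + k) = (\<Sum>j<r. a j * s (j + k)))"
    by (simp add: hankel_col_def)
  then show ?thesis
    by (simp add: lessThan_atLeast0 less_Suc_eq_le)
qed

text \<open>A square matrix over a field is singular iff it has a nonzero kernel vector. The vector
  is a function on \<open>nat\<close> of which only the values up to \<open>k\<close> count, so
  kernel conditions become sums of the same shape as the recurrence.\<close>

lemma det_hankel_mat_eq_0_iff:
  "det (hankel_mat s k) = 0 \<longleftrightarrow>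
    (\<exists>v. (\<exists>j\<le>k. v j \<noteq> 0) \<and> (\<forall>i\<le>k. (\<Sum>j\<le>k. v j * s (j + i)) = 0))"
proof -
  have carrier: "hankel_mat s k \<in> carrier_mat (k + 1) (k + 1)"
    by (simp add: hankel_mat_def)
  have nth: "(hankel_mat s k *\<^sub>v w) $ i = (\<Sum>j\<le>k. w $ j * s (j + i))"
    if "dim_vec w = k + 1" "i \<le> k" for w i
    using that
    by (simp add: hankel_mat_def scalar_prod_def atLeast0LessThan lessThan_Suc_atMost
        mult.commute add.commute)
  have kernel: "w \<noteq> 0\<^sub>v (k + 1) \<and> hankel_mat s k *\<^sub>v w = 0\<^sub>v (k + 1) \<longleftrightarrow>
      (\<exists>j\<le>k. w $ j \<noteq> 0) \<and> (\<forall>i\<le>k. (\<Sum>j\<le>k. w $ j * s (j + i)) = 0)"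
    if "w \<in> carrier_vec (k + 1)" for w
    using that nth[of w] carrier by (auto simp: vec_eq_iff less_Suc_eq_le)
  show ?thesis
    unfolding det_0_iff_vec_prod_zero[OF carrier]
  proof
    assume "\<exists>w. w \<in> carrier_vec (k + 1) \<and> w \<noteq> 0\<^sub>v (k + 1) \<and> hankel_mat s k *\<^sub>v w = 0\<^sub>v (k + 1)"
    then show "\<exists>v. (\<exists>j\<le>k. v j \<noteq> 0) \<and> (\<forall>i\<le>k. (\<Sum>j\<le>k. v j * s (j + i)) = 0)"
      using kernel by blast
  next
    assume "\<exists>v. (\<exists>j\<le>k. v j \<noteq> 0) \<and> (\<forall>i\<le>k. (\<Sum>j\<le>k. v j * s (j + i)) = 0)"
    then obtain v where "\<exists>j\<le>k. v j \<noteq> 0" "\<forall>i\<le>k. (\<Sum>j\<le>k. v j * s (j + i)) = 0"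
      by blast
    then have "(\<exists>j\<le>k. vec (k + 1) v $ j \<noteq> 0) \<and>
        (\<forall>i\<le>k. (\<Sum>j\<le>k. vec (k + 1) v $ j * s (j + i)) = 0)"
      by auto
    then show "\<exists>w. w \<in> carrier_vec (k + 1) \<and> w \<noteq> 0\<^sub>v (k + 1) \<and> hankel_mat s k *\<^sub>v w = 0\<^sub>v (k + 1)"
      using kernel[of "vec (k + 1) v"] vec_carrier by blast
  qed
qed

text \<open>Take the last index with nonzero coefficient and solve the relation for its term. If
  that index is 0, the sum is empty and \<open>f 0\<close> vanishes on \<open>K\<close>.\<close>

lemma dependent_imp_depends_on_predecessors:
  fixes v :: "nat \<Rightarrow> 'a :: field"
  assumes "\<exists>j\<le>m. v j \<noteq> 0" and zero: "\<And>k. k \<in> K \<Longrightarrow> (\<Sum>j\<le>m. v j * f j k) = 0"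
  shows "\<exists>q\<le>m. \<exists>a. \<forall>k\<in>K. f q k = (\<Sum>j<q. a j * f j k)"
proof -
  define q where "q = Max {j. j \<le> m \<and> v j \<noteq> 0}"
  have "q \<in> {j. j \<le> m \<and> v j \<noteq> 0}"
    unfolding q_def using assms(1) by (intro Max_in) auto
  then have q: "q \<le> m" "v q \<noteq> 0"
    by auto
  have above_q: "v j = 0" if "q < j" "j \<le> m" for j
    using that Max_ge[of "{j. j \<le> m \<and> v j \<noteq> 0}" j] unfolding q_def by fastforce
  have "f q k = (\<Sum>j<q. (- v j / v q) * f j k)" if "k \<in> K" for k
  proof -
    have "(\<Sum>j\<le>m. v j * f j k) = (\<Sum>j\<le>q. v j * f j k)"
      using q(1) above_q by (intro sum.mono_neutral_right) auto
    also have "\<dots> = (\<Sum>j<q. v j * f j k) + v q * f q k"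
      by (simp flip: lessThan_Suc_atMost)
    finally have "v q * f q k = - (\<Sum>j<q. v j * f j k)"
      using zero[OF that] by (simp add: eq_neg_iff_add_eq_0 add.commute)
    then have "f q k = - (\<Sum>j<q. v j * f j k) / v q"
      using q(2) by (simp add: field_simps)
    then show ?thesis
      by (simp add: sum_divide_distrib sum_negf)
  qed
  with q(1) show ?thesis
    by (intro exI[of _ q] conjI exI[of _ "\<lambda>j. - v j / v q"] ballI)
qed

lemma recurrence_imp_det_hankel_mat_eq_0:
  assumes recurrence: "\<forall>k\<le>n. s (r + k) = (\<Sum>j<r. a j * s (j + k))" and "r \<le> k" "k \<le> n"
  shows "det (hankel_mat s k) = 0"
proof -
  \<comment> \<open>The recurrence with all terms on one side, padded with zeros. The entry 1 at
    position \<open>r\<close> fits because \<open>r \<le> k\<close>, and \<open>k \<le> n\<close>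
    keeps all rows within the range of the recurrence.\<close>
  define v where "v j = (if j < r then - a j else if j = r then 1 else 0)" for j
  have "(\<Sum>j\<le>k. v j * s (j + i)) = 0" if "i \<le> k" for i
  proof -
    have "(\<Sum>j\<le>k. v j * s (j + i)) = (\<Sum>j\<le>r. v j * s (j + i))"
      using \<open>r \<le> k\<close> by (intro sum.mono_neutral_right) (auto simp: v_def)
    also have "\<dots> = (\<Sum>j<r. v j * s (j + i)) + v r * s (r + i)"
      by (simp flip: lessThan_Suc_atMost)
    also have "\<dots> = - (\<Sum>j<r. a j * s (j + i)) + s (r + i)"
      by (simp add: v_def sum_negf)
    finally show ?thesis
      using recurrence that \<open>k \<le> n\<close> by simp
  qed
  moreover have "v r \<noteq> 0"
    by (simp add: v_def)
  ultimately show ?thesis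
    using \<open>r \<le> k\<close> det_hankel_mat_eq_0_iff by blast
qed

text \<open>By the symmetry of a Hankel matrix the recurrence also acts on rows: within the first
  \<open>r\<close> columns, row \<open>i \<ge> r\<close> is a combination of rows
  \<open>i - r\<close> to \<open>i - 1\<close>. Strong induction on \<open>i\<close> then carries
  the kernel relation from row to row.\<close>

lemma recurrence_extends_kernel:
  fixes s :: "nat \<Rightarrow> 'a :: comm_semiring_0"
  assumes recurrence: "\<forall>k\<le>n. s (r + k) = (\<Sum>j<r. a j * s (j + k))"
    and kernel: "\<And>i. i < r \<Longrightarrow> (\<Sum>j<r. v j * s (j + i)) = 0" and "i \<le> n"
  shows "(\<Sum>j<r. v j * s (j + i)) = 0"
  using \<open>i \<le> n\<close>
proof (induction i rule: less_induct)
  case (less i)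
  show ?case
  proof (cases "i < r")
    case True
    then show ?thesis
      by (rule kernel)
  next
    case False
    have "s (j + i) = (\<Sum>l<r. a l * s (j + (l + (i - r))))" if "j < r" for j
    proof -
      \<comment> \<open>The restriction to columns \<open>j < r\<close> makes this shift less than
        \<open>i\<close>, hence within the range of the recurrence.\<close>
      have "j + (i - r) \<le> n"
        using that False less.prems by linarith
      with recurrence have "s (r + (j + (i - r))) = (\<Sum>l<r. a l * s (l + (j + (i - r))))"
        by blast
      with False show ?thesis
        by (simp add: add.left_commute)
    qed
    then have "(\<Sum>j<r. v j * s (j + i)) = (\<Sum>j<r. \<Sum>l<r. a l * (v j * s (j + (l + (i - r)))))"
      by (simp add: sum_distrib_left mult.left_commute)
    \<comment> \<open>Exchanging the sums exposes the kernel relations of the earlier rows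
      \<open>l + (i - r)\<close>.\<close>
    also have "\<dots> = (\<Sum>l<r. a l * (\<Sum>j<r. v j * s (j + (l + (i - r)))))"
      by (subst sum.swap) (simp add: sum_distrib_left)
    also have "\<dots> = 0"
    proof (intro sum.neutral ballI)
      fix l assume "l \<in> {..<r}"
      then have "l + (i - r) < i" and "l + (i - r) \<le> n"
        using False less.prems by auto
      then show "a l * (\<Sum>j<r. v j * s (j + (l + (i - r)))) = 0"
        by (simp only: less.IH mult_zero_right)
    qed
    finally show ?thesis .
  qed
qed

theorem lemma5p3:
  fixes s :: "nat \<Rightarrow> real" and n :: nat
  assumes "det (hankel_mat s n) = 0"
  shows "hankel_rank s n = largest_normal_index s n"
proof -
  define P where "P r \<longleftrightarrow> (\<exists>a. \<forall>k\<le>n. s (r + k) = (\<Sum>j<r. a j * s (j + k)))" for r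
  define r where "r = (LEAST r. r \<le> n \<and> P r)"
  have rank: "hankel_rank s n = r"
    using assms by (simp only: hankel_rank_def r_def P_def hankel_col_in_span_iff) simp
  have "\<exists>r\<le>n. P r"
  proof -
    obtain v where "\<exists>j\<le>n. v j \<noteq> 0" "\<forall>i\<le>n. (\<Sum>j\<le>n. v j * s (j + i)) = 0"
      using assms unfolding det_hankel_mat_eq_0_iff by blast
    then show ?thesis
      using dependent_imp_depends_on_predecessors[of n v "{..n}" "\<lambda>j k. s (j + k)"]
      by (auto simp: P_def)
  qed
  then have "r \<le> n \<and> P r"
    unfolding r_def by (rule LeastI_ex)
  then obtain a where "r \<le> n" and recurrence: "\<forall>k\<le>n. s (r + k) = (\<Sum>j<r. a j * s (j + k))"
    by (auto simp: P_def)
  have minimal: "\<not> P q" if "q < r" for q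
    using that \<open>r \<le> n\<close> not_less_Least[of q "\<lambda>r. r \<le> n \<and> P r"] unfolding r_def by auto
  \<comment> \<open>The index \<open>j\<close> belongs to the matrix of subscript
    \<open>j - 1\<close>; \<open>j > r\<close> would give \<open>r \<le> j - 1 \<le> n\<close>,
    where the determinant vanishes.\<close>
  have upper: "j \<le> r" if "j \<in> normal_indices s n" for j
    using that recurrence_imp_det_hankel_mat_eq_0[OF recurrence, of "j - 1"]
    by (force simp: normal_indices_def)
  have normal: "r \<in> normal_indices s n" if "r > 0"
  proof -
    have "det (hankel_mat s (r - 1)) \<noteq> 0"
    proof
      assume "det (hankel_mat s (r - 1)) = 0"
      then obtain v where v: "\<exists>j\<le>r - 1. v j \<noteq> 0" "\<forall>i\<le>r - 1. (\<Sum>j\<le>r - 1. v j * s (j + i)) = 0"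
        unfolding det_hankel_mat_eq_0_iff by blast
      have "{..r - 1} = {..<r}"
        using that by auto
      \<comment> \<open>The relation now holds along full columns of length \<open>n + 1\<close>,
        the length used in the definition of the rank, so it yields \<open>P q\<close> for some
        \<open>q < r\<close>.\<close>
      with v(2) have "(\<Sum>j\<le>r - 1. v j * s (j + i)) = 0" if "i \<le> n" for i
        using recurrence_extends_kernel[OF recurrence _ that, of v] by auto
      then obtain q where "q \<le> r - 1" "P q"
        using dependent_imp_depends_on_predecessors[of "r - 1" v "{..n}" "\<lambda>j k. s (j + k)"] v(1)
        by (auto simp: P_def)
      then show False
        using minimal[of q] that by simp
    qed
    with that \<open>r \<le> n\<close> show ?thesis
      by (simp add: normal_indices_def)
  qed
  have "largest_normal_index s n = r"
  proof (cases "r = 0")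
    \<comment> \<open>Normal indices start at 1, so the bound \<open>j \<le> 0\<close> leaves none
      and the default value 0 applies.\<close>
    case True
    with upper have "normal_indices s n = {}"
      by (fastforce simp: normal_indices_def)
    with True show ?thesis
      by (simp add: largest_normal_index_def)
  next
    case False
    moreover have "finite (normal_indices s n)"
      by (simp add: normal_indices_def)
    ultimately show ?thesis
      using normal upper by (auto simp: largest_normal_index_def intro: Max_eqI)
  qed
  with rank show ?thesis
    by simp
qed

end
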